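(* Let $l,k$ be integers with $l\ge k\ge 2$. Let $G$ be a connected $d$-regular graph with $|V(G)|\ge k+l-1$, $d\ge 3$ and edge connectivity $\kappa'$. Suppose that either $\kappa'=d$, or $\kappa'<d$ and \[ \lambda_{\left\lceil\frac{(l-k+1)d}{d-\kappa'}\right\rceil}(G) < \begin{cases} \frac{d-2+\sqrt{d^2+12}}{2}, & \text{if } d \text{ is even},\\ \frac{d-2+\sqrt{d^2+8}}{2}, & \text{if } d \text{ is odd}.\end{cases} \] Then $\kappa_l(G)\ge k$.
   Context: All graphs are finite, undirected and simple. For a graph $G$ of order $n$, $\lambda_1(G)\ge\lambda_2(G)\ge\dots\ge\lambda_n(G)$ denote the eigenvalues of its adjacency matrix (with multiplicity). The edge connectivity of $G$ is denoted $\kappa'=\kappa'(G)$. For an integer $l\ge 2$, the $l$-connectivity $\kappa_l(G)$ is the minimum number of vertices of $G$ whose removal produces a disconnected graph with at least $l$ components or a graph with fewer than $l$ vertices. *)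

theory Defs
  imports
    Complex_Main
    "Jordan_Normal_Form.Char_Poly"
    "Graph_Theory.Digraph_Component"
begin

text \<open>
  Finite simple undirected graphs are the symmetric, loop-free digraphs without parallel arcs
  of the locale \<^locale>\<open>graph\<close>; an undirected edge is represented by its two opposite arcs.
  Hence the degree of a vertex is its out-degree, and the connected components are the
  strongly connected components.
\<close>

definition vertex_list :: "('a, 'b) pre_digraph \<Rightarrow> 'a list" where
  "vertex_list G = (SOME vs. distinct vs \<and> set vs = verts G)"

definition adjacency_matrix :: "('a, 'b) pre_digraph \<Rightarrow> real mat" where
  "adjacency_matrix G =
    (let vs = vertex_list G; n = length vs
     in mat n n (\<lambda>(i, j). if (vs ! i, vs ! j) \<in> arcs_ends G then 1 else 0))"

text \<open>
  The eigenvalues with multiplicity, as roots of the characteristic polynomial, in decreasing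
  order. They do not depend on the enumeration chosen in \<^const>\<open>vertex_list\<close>, since two
  enumerations give permutation-similar matrices. As the matrix is real symmetric, there are
  exactly as many of them as vertices.
\<close>

definition graph_eigenvalues :: "('a, 'b) pre_digraph \<Rightarrow> real list" where
  "graph_eigenvalues G =
    rev (sorted_list_of_multiset (proots (char_poly (adjacency_matrix G))))"

text \<open>Indices start at 1; the value is meaningful only for \<open>1 \<le> i \<le> card (verts G)\<close>.\<close>

definition graph_eigenvalue :: "('a, 'b) pre_digraph \<Rightarrow> nat \<Rightarrow> real" where
  "graph_eigenvalue G i = graph_eigenvalues G ! (i - 1)"

definition regular_graph :: "('a, 'b) pre_digraph \<Rightarrow> nat \<Rightarrow> bool" where
  "regular_graph G d \<longleftrightarrow> (\<forall>v \<in> verts G. out_degree G v = d)"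

definition graph_edges :: "('a, 'b) pre_digraph \<Rightarrow> 'a set set" where
  "graph_edges G = (\<lambda>a. {tail G a, head G a}) ` arcs G"

definition delete_edges :: "('a, 'b) pre_digraph \<Rightarrow> 'a set set \<Rightarrow> ('a, 'b) pre_digraph" where
  "delete_edges G F = G\<lparr>arcs := {a \<in> arcs G. {tail G a, head G a} \<notin> F}\<rparr>"

definition delete_vertices :: "('a, 'b) pre_digraph \<Rightarrow> 'a set \<Rightarrow> ('a, 'b) pre_digraph" where
  "delete_vertices G S = G \<restriction> (verts G - S)"

text \<open>
  A single vertex cannot be disconnected by deleting edges; its edge connectivity is 0,
  the infimum of the empty set of natural numbers.
\<close>

definition edge_connectivity :: "('a, 'b) pre_digraph \<Rightarrow> nat" where
  "edge_connectivity G =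
    Inf {card F | F. F \<subseteq> graph_edges G \<and> \<not> Digraph_Component.connected (delete_edges G F)}"

text \<open>For \<open>l \<ge> 1\<close> the minimum exists, since deleting all vertices leaves fewer than \<open>l\<close>.\<close>

definition l_connectivity :: "nat \<Rightarrow> ('a, 'b) pre_digraph \<Rightarrow> nat" where
  "l_connectivity l G =
    Inf {card S | S. S \<subseteq> verts G \<and>
      (let H = delete_vertices G S in
        (\<not> Digraph_Component.connected H \<and> card (pre_digraph.sccs H) \<ge> l)
        \<or> card (verts H) < l)}"

end

theory Submission
  imports Defs "Jordan_Normal_Form.Spectral_Radius"
begin

text \<open>
  Suppose that removing a set \<open>S\<close> of at most \<open>k - 1\<close> vertices leaves at least \<open>l\<close> components; by
  the bound on the number of vertices, this is the only way in which the conclusion can fail.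
  All edges leaving a component end in \<open>S\<close>, so the components together send out at most
  \<open>d (k - 1)\<close> edges (\<open>sum_boundary_components_le\<close>), while each of them sends out at least \<open>\<kappa>'\<close>
  (\<open>edge_connectivity_le_boundary\<close>). If \<open>\<kappa>' = d\<close>, then \<open>l d \<le> d (k - 1)\<close>, which contradicts
  \<open>l \<ge> k\<close>. If \<open>\<kappa>' < d\<close>, then counting shows that at least
  \<open>T = \<lceil>(l - k + 1) d / (d - \<kappa>')\<rceil>\<close> components send out fewer than \<open>d\<close> edges
  (\<open>many_small_terms_of_small_sum\<close>).

  Such a component is almost \<open>d\<close>-regular, and its adjacency form has a Rayleigh quotient at least
  the threshold \<open>\<theta>\<close> of the theorem (\<open>near_regular_set_test_function\<close>). The threshold is the
  largest eigenvalue of the extremal example: the complete graph on \<open>d + 1\<close> vertices minus a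
  matching that misses \<open>r\<close> vertices, with \<open>r = 3\<close> for even and \<open>r = 2\<close> for odd \<open>d\<close>. Both cases
  have the form \<open>\<theta> = (d - 2 + sqrt (d\<^sup>2 + 4 r)) / 2\<close>.

  The components are disjoint and no edges join them, so their test functions span a space of
  dimension at least \<open>T\<close> on which the adjacency form is at least \<open>\<theta>\<close> times the square of the
  norm. By the variational principle the \<open>T\<close>-th eigenvalue is at least \<open>\<theta>\<close>
  (\<open>separated_test_functions_eigenvalue\<close>), against the hypothesis. The variational principle
  (\<open>rayleigh_subspace_eigenvalue_count\<close>) in turn rests on the orthogonal diagonalization of real
  symmetric matrices.
\<close>

section \<open>Spectral theory of real symmetric matrices\<close>

text \<open>
  Take a complex eigenvector \<open>x + \<i>y\<close> with eigenvalue \<open>a + \<i>b\<close>. Symmetry makes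
  \<open>Ax \<bullet> y = Ay \<bullet> x\<close>, which reads \<open>b (x \<bullet> x + y \<bullet> y) = 0\<close>. So \<open>b = 0\<close>, and whichever of
  \<open>x\<close>, \<open>y\<close> is nonzero is a real eigenvector.
\<close>

lemma real_symmetric_has_eigenvector:
  fixes A :: "real mat"
  assumes A: "A \<in> carrier_mat n n" and sym: "transpose_mat A = A" and n: "n > 0"
  obtains a v where "v \<in> carrier_vec n" "v \<noteq> 0\<^sub>v n" "A *\<^sub>v v = a \<cdot>\<^sub>v v"
proof -
  define B where "B = map_mat complex_of_real A"
  have B: "B \<in> carrier_mat n n" using A by (simp add: B_def)
  obtain k w where w: "w \<in> carrier_vec n" "w \<noteq> 0\<^sub>v n" "B *\<^sub>v w = k \<cdot>\<^sub>v w"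
    using spectrum_non_empty[OF B n] B
    by (auto simp: spectrum_def eigenvalue_def eigenvector_def)
  define x where "x = map_vec Re w"
  define y where "y = map_vec Im w"
  have xy: "x \<in> carrier_vec n" "y \<in> carrier_vec n"
    using w(1) by (auto simp: x_def y_def)
  have row: "(\<Sum>j<n. complex_of_real (A $$ (i,j)) * w $ j) = k * w $ i" if "i < n" for i
  proof -
    have "(B *\<^sub>v w) $ i = (\<Sum>j<n. complex_of_real (A $$ (i,j)) * w $ j)"
      using that A w(1) by (simp add: B_def scalar_prod_def lessThan_atLeast0)
    then show ?thesis using w that by simp
  qed
  have Ax: "A *\<^sub>v x = Re k \<cdot>\<^sub>v x - Im k \<cdot>\<^sub>v y"
  proof (rule eq_vecI)
    fix i assume "i < dim_vec (Re k \<cdot>\<^sub>v x - Im k \<cdot>\<^sub>v y)"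
    then have i: "i < n" using xy by simp
    have "(A *\<^sub>v x) $ i = (\<Sum>j<n. A $$ (i,j) * Re (w $ j))"
      using i A w(1) by (simp add: scalar_prod_def lessThan_atLeast0 x_def)
    also have "\<dots> = Re (\<Sum>j<n. complex_of_real (A $$ (i,j)) * w $ j)"
      by simp
    also have "\<dots> = (Re k \<cdot>\<^sub>v x - Im k \<cdot>\<^sub>v y) $ i"
      unfolding row[OF i] using i w(1) by (simp add: x_def y_def)
    finally show "(A *\<^sub>v x) $ i = (Re k \<cdot>\<^sub>v x - Im k \<cdot>\<^sub>v y) $ i" .
  qed (use A xy in auto)
  have Ay: "A *\<^sub>v y = Im k \<cdot>\<^sub>v x + Re k \<cdot>\<^sub>v y"
  proof (rule eq_vecI)
    fix i assume "i < dim_vec (Im k \<cdot>\<^sub>v x + Re k \<cdot>\<^sub>v y)"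
    then have i: "i < n" using xy by simp
    have "(A *\<^sub>v y) $ i = (\<Sum>j<n. A $$ (i,j) * Im (w $ j))"
      using i A w(1) by (simp add: scalar_prod_def lessThan_atLeast0 y_def)
    also have "\<dots> = Im (\<Sum>j<n. complex_of_real (A $$ (i,j)) * w $ j)"
      by simp
    also have "\<dots> = (Im k \<cdot>\<^sub>v x + Re k \<cdot>\<^sub>v y) $ i"
      unfolding row[OF i] using i w(1) by (simp add: x_def y_def)
    finally show "(A *\<^sub>v y) $ i = (Im k \<cdot>\<^sub>v x + Re k \<cdot>\<^sub>v y) $ i" .
  qed (use A xy in auto)
  have nz: "x \<noteq> 0\<^sub>v n \<or> y \<noteq> 0\<^sub>v n"
  proof (rule ccontr)
    assume "\<not> ?thesis"
    then have "x $ i = 0" "y $ i = 0" if "i < n" for i using that by auto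
    then have "w = 0\<^sub>v n"
      using w(1) by (intro eq_vecI) (auto simp: x_def y_def complex_eq_iff)
    then show False using w(2) by simp
  qed
  have sq: "u \<bullet> u = (\<Sum>i<n. (u $ i)\<^sup>2)" if "u \<in> carrier_vec n" for u :: "real vec"
    using that by (simp add: scalar_prod_def power2_eq_square lessThan_atLeast0)
  have "(A *\<^sub>v x) \<bullet> y = (A *\<^sub>v y) \<bullet> x"
    using transpose_vec_mult_scalar[OF A xy] sym comm_scalar_prod[of x n "A *\<^sub>v y"] A xy
      transpose_vec_mult_scalar[OF A xy(2) xy(1)]  by (simp add: comm_scalar_prod[of x n "A *\<^sub>v y"])
  moreover have "(A *\<^sub>v x) \<bullet> y = Re k * (x \<bullet> y) - Im k * (y \<bullet> y)"
    unfolding Ax using xy by (simp add: minus_scalar_prod_distrib[of _ n])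
  moreover have "(A *\<^sub>v y) \<bullet> x = Im k * (x \<bullet> x) + Re k * (x \<bullet> y)"
    unfolding Ay using xy by (simp add: add_scalar_prod_distrib[of _ n] comm_scalar_prod[of x n y])
  ultimately have "Im k * (x \<bullet> x + y \<bullet> y) = 0" by (simp add: algebra_simps)
  moreover have "x \<bullet> x + y \<bullet> y \<noteq> 0"
  proof
    assume "x \<bullet> x + y \<bullet> y = 0"
    then have "(\<Sum>i<n. (x $ i)\<^sup>2 + (y $ i)\<^sup>2) = 0"
      using xy by (simp add: sq sum.distrib)
    then have "\<forall>i<n. (x $ i)\<^sup>2 + (y $ i)\<^sup>2 = 0"
      by (subst (asm) sum_nonneg_eq_0_iff) auto
    then have "x = 0\<^sub>v n" "y = 0\<^sub>v n"
      using xy by (auto intro!: eq_vecI simp: sum_power2_eq_zero_iff)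
    then show False using nz by simp
  qed
  ultimately have "Im k = 0" by simp
  then have "A *\<^sub>v x = Re k \<cdot>\<^sub>v x" "A *\<^sub>v y = Re k \<cdot>\<^sub>v y"
    unfolding Ax Ay using xy by (auto intro!: eq_vecI)
  then show thesis using nz xy that by blast
qed

text \<open>
  The Householder reflection in the hyperplane orthogonal to \<open>v - e\<^sub>0\<close>. It completes \<open>v\<close> to
  an orthonormal basis by an explicit matrix that is its own inverse and transpose, so that
  conjugation with it keeps a matrix symmetric.
\<close>

lemma reflection_onto_unit_vector:
  fixes v :: "real vec"
  assumes v: "v \<in> carrier_vec n" and unit: "v \<bullet> v = 1" and n: "n > 0"
  obtains Q where "Q \<in> carrier_mat n n" "transpose_mat Q = Q" "Q * Q = 1\<^sub>m n"
    "Q *\<^sub>v unit_vec n 0 = v"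
proof -
  define w where "w i = v $ i - (if i = 0 then 1 else 0)" for i
  define s where "s = (\<Sum>i<n. w i * w i)"
  \<comment> \<open>For \<open>v = e\<^sub>0\<close> we have \<open>s = 0\<close>, and division by zero gives \<open>c = 0\<close>, so \<open>Q\<close> is the identity.\<close>
  define c where "c = 2 / s"
  define Q where "Q = mat n n (\<lambda>(i, j). (if i = j then 1 else 0) - c * (w i * w j))"
  have Q: "Q \<in> carrier_mat n n" by (simp add: Q_def)
  have "transpose_mat Q = Q"
    by (rule eq_matI) (auto simp: Q_def mult.commute)
  moreover have "Q * Q = 1\<^sub>m n"
  proof (rule eq_matI)
    fix i j assume "i < dim_row (1\<^sub>m n :: real mat)" "j < dim_col (1\<^sub>m n :: real mat)"
    then have ij: "i < n" "j < n" by auto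
    have "(Q * Q) $$ (i, j) = (\<Sum>k<n. ((if i = k then 1 else 0) - c * (w i * w k))
        * ((if k = j then 1 else 0) - c * (w k * w j)))"
      using ij by (simp add: Q_def scalar_prod_def lessThan_atLeast0)
    also have "\<dots> = (\<Sum>k<n. (if i = k then (if k = j then 1 else 0) - c * (w k * w j) else 0)
        - (if k = j then c * (w i * w k) else 0) + c * c * w i * w j * (w k * w k))"
      by (rule sum.cong) (auto simp: algebra_simps)
    also have "\<dots> = (if i = j then 1 else 0) - c * (w j * w i) - c * (w i * w j)
        + c * c * w i * w j * s"
      using ij by (simp add: sum.distrib sum_subtractf s_def sum_distrib_left mult.commute)
    also have "\<dots> = (if i = j then 1 else 0) - 2 * c * (w i * w j) + c * c * s * (w i * w j)"
      by (simp add: algebra_simps)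
    also have "c * c * s = 2 * c" by (simp add: c_def)
    finally show "(Q * Q) $$ (i, j) = 1\<^sub>m n $$ (i, j)" using ij by simp
  qed (use Q in auto)
  moreover have "Q *\<^sub>v unit_vec n 0 = v"
  proof (rule eq_vecI)
    fix i assume "i < dim_vec v"
    then have i: "i < n" using v by simp
    have vv: "(\<Sum>i<n. v $ i * v $ i) = 1"
      using unit v by (simp add: scalar_prod_def lessThan_atLeast0)
    have "s = (\<Sum>i<n. v $ i * v $ i + (if i = 0 then 1 - 2 * v $ 0 else 0))"
      unfolding s_def w_def by (rule sum.cong) (auto simp: algebra_simps)
    also have "\<dots> = 2 - 2 * v $ 0"
      using n vv by (simp add: sum.distrib)
    finally have s: "s = - 2 * w 0" by (simp add: w_def)
    have "- c * w 0 * w i = w i"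
    proof (cases "s = 0")
      case True
      then have "w i * w i = 0"
        unfolding s_def using i by (subst (asm) sum_nonneg_eq_0_iff) auto
      then show ?thesis by simp
    next
      case False
      then show ?thesis using s by (simp add: c_def)
    qed
    moreover have "(Q *\<^sub>v unit_vec n 0) $ i = (if i = 0 then 1 else 0) - c * (w i * w 0)"
      using i n by (simp add: Q_def)
    ultimately have "(Q *\<^sub>v unit_vec n 0) $ i = (if i = 0 then 1 else 0) + w i"
      by (simp add: algebra_simps)
    then show "(Q *\<^sub>v unit_vec n 0) $ i = v $ i" by (simp add: w_def)
  qed (use Q v in auto)
  ultimately show thesis using that Q by blast
qed

lemma scale_to_unit_vector:
  fixes v :: "real vec"
  assumes v: "v \<in> carrier_vec n" "v \<noteq> 0\<^sub>v n"
  obtains c where "(c \<cdot>\<^sub>v v) \<bullet> (c \<cdot>\<^sub>v v) = 1"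
proof -
  have "v \<bullet> v > 0"
  proof -
    obtain i where "i < n" "v $ i \<noteq> 0" using v by (metis carrier_vecD eq_vecI index_zero_vec)
    then have "(\<Sum>i<n. v $ i * v $ i) > 0"
      by (intro sum_pos2[of _ i]) (auto simp: zero_less_mult_iff linorder_neq_iff)
    then show ?thesis using v by (simp add: scalar_prod_def lessThan_atLeast0)
  qed
  then have "(1 / sqrt (v \<bullet> v) \<cdot>\<^sub>v v) \<bullet> (1 / sqrt (v \<bullet> v) \<cdot>\<^sub>v v) = 1"
    using v by simp
  then show thesis by (rule that)
qed

text \<open>
  Reflect a unit eigenvector to \<open>e\<^sub>0\<close>: the conjugated matrix is symmetric and its first column
  is a multiple of \<open>e\<^sub>0\<close>, hence so is its first row, and the remaining block is symmetric of
  smaller size.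
\<close>

theorem real_symmetric_diagonalization:
  fixes A :: "real mat"
  assumes "A \<in> carrier_mat n n" "transpose_mat A = A"
  shows "\<exists>P D. P \<in> carrier_mat n n \<and> D \<in> carrier_mat n n \<and> diagonal_mat D
    \<and> transpose_mat P * P = 1\<^sub>m n \<and> A = P * D * transpose_mat P"
  using assms
proof (induction n arbitrary: A)
  case 0
  then show ?case
    by (intro exI[of _ "1\<^sub>m 0"] exI[of _ A]) (auto simp: diagonal_mat_def)
next
  case (Suc m)
  let ?n = "Suc m"
  note A = Suc.prems(1) and sym = Suc.prems(2)
  obtain a v0 where v0: "v0 \<in> carrier_vec ?n" "v0 \<noteq> 0\<^sub>v ?n" "A *\<^sub>v v0 = a \<cdot>\<^sub>v v0"
    using real_symmetric_has_eigenvector[OF A sym] by blast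
  obtain c where c: "(c \<cdot>\<^sub>v v0) \<bullet> (c \<cdot>\<^sub>v v0) = 1"
    using scale_to_unit_vector[OF v0(1,2)] .
  define v where "v = c \<cdot>\<^sub>v v0"
  have v: "v \<in> carrier_vec ?n" "v \<bullet> v = 1" using v0 c by (auto simp: v_def)
  have Av: "A *\<^sub>v v = a \<cdot>\<^sub>v v"
    unfolding v_def using v0 A by (simp add: mult_mat_vec smult_smult_assoc mult.commute)
  obtain Q where Q: "Q \<in> carrier_mat ?n ?n" "transpose_mat Q = Q" "Q * Q = 1\<^sub>m ?n"
    "Q *\<^sub>v unit_vec ?n 0 = v"
    using reflection_onto_unit_vector[OF v] by blast
  define B where "B = Q * A * Q"
  have B: "B \<in> carrier_mat ?n ?n" using Q A by (simp add: B_def)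
  have symB: "transpose_mat B = B"
    unfolding B_def using Q A sym
    by (simp add: transpose_mult[of _ ?n ?n _ ?n] assoc_mult_mat[of _ ?n ?n _ ?n _ ?n])
  have "Q *\<^sub>v v = (Q * Q) *\<^sub>v unit_vec ?n 0"
    unfolding Q(4)[symmetric] using Q(1) by (simp add: assoc_mult_mat_vec[of _ ?n ?n _ ?n])
  then have Qv: "Q *\<^sub>v v = unit_vec ?n 0" using Q(3) by simp
  have "B *\<^sub>v unit_vec ?n 0 = Q *\<^sub>v (A *\<^sub>v (Q *\<^sub>v unit_vec ?n 0))"
    unfolding B_def using Q(1) A by (simp add: assoc_mult_mat_vec[of _ ?n ?n _ ?n])
  also have "\<dots> = a \<cdot>\<^sub>v unit_vec ?n 0"
    unfolding Q(4) Av using Q(1) v(1) by (simp add: mult_mat_vec Qv)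
  finally have Be: "B *\<^sub>v unit_vec ?n 0 = a \<cdot>\<^sub>v unit_vec ?n 0" .
  have col0: "B $$ (i, 0) = (if i = 0 then a else 0)" if "i < ?n" for i
  proof -
    have "(B *\<^sub>v unit_vec ?n 0) $ i = B $$ (i, 0)" using that B by simp
    then show ?thesis unfolding Be using that by (cases "i = 0") auto
  qed
  have row0: "B $$ (0, i) = (if i = 0 then a else 0)" if "i < ?n" for i
    using col0[OF that] symB B that by (metis carrier_matD index_transpose_mat(1) zero_less_Suc)
  define B' where "B' = mat m m (\<lambda>(i, j). B $$ (Suc i, Suc j))"
  let ?a = "mat 1 1 (\<lambda>_. a)"
  have B': "B' \<in> carrier_mat m m" by (simp add: B'_def)
  have "transpose_mat B' = B'"
  proof (rule eq_matI)
    fix i j assume "i < dim_row B'" "j < dim_col B'"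
    then have "i < m" "j < m" by (auto simp: B'_def)
    then show "transpose_mat B' $$ (i, j) = B' $$ (i, j)"
      using symB B unfolding B'_def
      by simp (metis Suc_less_eq carrier_matD index_transpose_mat(1))
  qed (auto simp: B'_def)
  from Suc.IH[OF B' this] obtain P' D' where P': "P' \<in> carrier_mat m m"
    and D': "D' \<in> carrier_mat m m" "diagonal_mat D'"
    and PP': "transpose_mat P' * P' = 1\<^sub>m m" and dec: "B' = P' * D' * transpose_mat P'" by blast
  have Bblock: "B = four_block_mat ?a (0\<^sub>m 1 m) (0\<^sub>m m 1) B'"
  proof (rule eq_matI)
    fix i j assume "i < dim_row (four_block_mat ?a (0\<^sub>m 1 m) (0\<^sub>m m 1) B')"
      "j < dim_col (four_block_mat ?a (0\<^sub>m 1 m) (0\<^sub>m m 1) B')"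
    then have "i < ?n" "j < ?n" by (auto simp: B'_def)
    then show "B $$ (i, j) = four_block_mat ?a (0\<^sub>m 1 m) (0\<^sub>m m 1) B' $$ (i, j)"
      using col0[of i] row0[of j] by (cases i; cases j) (auto simp: B'_def)
  qed (use B in \<open>auto simp: B'_def\<close>)
  define F where "F = four_block_mat (1\<^sub>m 1) (0\<^sub>m 1 m) (0\<^sub>m m 1) P'"
  define E where "E = four_block_mat ?a (0\<^sub>m 1 m) (0\<^sub>m m 1) D'"
  have F: "F \<in> carrier_mat ?n ?n" and E: "E \<in> carrier_mat ?n ?n"
    using four_block_carrier_mat[of "1\<^sub>m 1" 1 1 P' m m] four_block_carrier_mat[of ?a 1 1 D' m m]
      P' D' by (auto simp: F_def E_def)
  have FT: "transpose_mat F = four_block_mat (1\<^sub>m 1) (0\<^sub>m 1 m) (0\<^sub>m m 1) (transpose_mat P')"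
    unfolding F_def using P' by (subst transpose_four_block_mat) auto
  have "transpose_mat F * F = four_block_mat (1\<^sub>m 1) (0\<^sub>m 1 m) (0\<^sub>m m 1) (1\<^sub>m m)"
    unfolding FT unfolding F_def using P' PP'
    by (subst mult_four_block_mat[of _ 1 1 _ m _ m _ _ 1 _ m]) auto
  then have FF: "transpose_mat F * F = 1\<^sub>m ?n" by simp
  have "F * E = four_block_mat ?a (0\<^sub>m 1 m) (0\<^sub>m m 1) (P' * D')"
    unfolding F_def E_def using P' D'
    by (subst mult_four_block_mat[of _ 1 1 _ m _ m _ _ 1 _ m]) auto
  then have "F * E * transpose_mat F = four_block_mat ?a (0\<^sub>m 1 m) (0\<^sub>m m 1) B'"
    unfolding FT dec using P' D'
    by (simp, subst mult_four_block_mat[of _ 1 1 _ m _ m _ _ 1 _ m]) auto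
  then have BF: "B = F * E * transpose_mat F" using Bblock by simp
  define P where "P = Q * F"
  have P: "P \<in> carrier_mat ?n ?n" using Q F by (simp add: P_def)
  have PT: "transpose_mat P = transpose_mat F * Q"
    unfolding P_def using Q F by (simp add: transpose_mult[of _ ?n ?n _ ?n])
  have "transpose_mat P * P = transpose_mat F * (Q * Q) * F"
    unfolding PT unfolding P_def using Q(1) F by (simp add: assoc_mult_mat[of _ ?n ?n _ ?n _ ?n])
  then have PP: "transpose_mat P * P = 1\<^sub>m ?n" using Q(3) F FF by simp
  have "P * E * transpose_mat P = Q * B * Q"
    unfolding PT BF unfolding P_def using Q(1) F E by (simp add: assoc_mult_mat[of _ ?n ?n _ ?n _ ?n])
  also have "\<dots> = (Q * Q) * A * (Q * Q)"
    unfolding B_def using Q(1) A by (simp add: assoc_mult_mat[of _ ?n ?n _ ?n _ ?n])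
  also have "\<dots> = A" using Q(3) A by simp
  finally have dA: "A = P * E * transpose_mat P" by simp
  have "diagonal_mat E"
    unfolding diagonal_mat_def
  proof (intro allI impI)
    fix i j assume "i < dim_row E" "j < dim_col E" "i \<noteq> j"
    then show "E $$ (i, j) = 0"
      using D' unfolding E_def diagonal_mat_def by (cases i; cases j) auto
  qed
  then show ?case using P E PP dA by blast
qed

lemma diagonal_char_poly_proots:
  fixes D :: "real mat"
  assumes D: "D \<in> carrier_mat n n" "diagonal_mat D"
  shows "proots (char_poly D) = mset (diag_mat D)"
proof -
  have "upper_triangular D"
    using D by (auto simp: diagonal_mat_def)
  then have "char_poly D = (\<Prod>a\<leftarrow>diag_mat D. [:- a, 1:])"
    using char_poly_upper_triangular[OF D(1)] by blast
  moreover have "proots (\<Prod>a\<leftarrow>es. [:- a, 1:]) = mset es" for es :: "real list"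
  proof (induction es)
    case (Cons a es)
    have "(\<Prod>a\<leftarrow>es. [:- a, 1:]) \<noteq> 0" by (auto simp: prod_list_zero_iff)
    then have "proots ([:- a, 1:] * (\<Prod>a\<leftarrow>es. [:- a, 1:])) =
        proots [:- a, 1:] + proots (\<Prod>a\<leftarrow>es. [:- a, 1:])"
      by (intro proots_mult) auto
    then show ?case using Cons by simp
  qed simp
  ultimately show ?thesis by simp
qed

text \<open>
  Pad the rows of \<open>Y\<close> selected by \<open>J\<close> with zero rows to a square matrix; a zero row makes it
  singular.
\<close>

lemma underdetermined_system_nontrivial_solution:
  fixes Y :: "'a :: field mat"
  assumes Y: "Y \<in> carrier_mat n t" and J: "J \<subseteq> {..<n}" "card J < t"
  obtains c where "c \<in> carrier_vec t" "c \<noteq> 0\<^sub>v t" "\<And>i. i \<in> J \<Longrightarrow> (Y *\<^sub>v c) $ i = 0"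
proof -
  have finJ: "finite J" using J finite_subset by blast
  obtain f where f: "bij_betw f {0..<card J} J"
    using ex_bij_betw_nat_finite[OF finJ] by blast
  define M where "M = mat t t (\<lambda>(r, j). if r < card J then Y $$ (f r, j) else 0)"
  have M: "M \<in> carrier_mat t t" by (simp add: M_def)
  have t: "t - 1 < t" using J by simp
  \<comment> \<open>The last row of \<open>M\<close> is zero, since \<open>card J < t\<close>.\<close>
  have "transpose_mat M *\<^sub>v unit_vec t (t - 1) = 0\<^sub>v t"
    using t J by (intro eq_vecI) (auto simp: M_def)
  moreover have "unit_vec t (t - 1) \<noteq> (0\<^sub>v t :: 'a vec)"
    using t by (metis index_unit_vec(1) index_zero_vec(1) one_neq_zero)
  ultimately have "det (transpose_mat M) = 0"
    using M by (subst det_0_iff_vec_prod_zero[of _ t]) (auto intro!: exI[of _ "unit_vec t (t - 1)"])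
  then have "det M = 0" using det_transpose[OF M] by simp
  then obtain c where c: "c \<in> carrier_vec t" "c \<noteq> 0\<^sub>v t" "M *\<^sub>v c = 0\<^sub>v t"
    using det_0_iff_vec_prod_zero[OF M] by blast
  show thesis
  proof (rule that[OF c(1,2)])
    fix i assume "i \<in> J"
    then obtain r where r: "r < card J" "f r = i"
      using f unfolding bij_betw_def by (metis atLeastLessThan_iff imageE)
    have i: "i < n" using \<open>i \<in> J\<close> J by auto
    have "row M r = row Y i"
      using r J i Y by (intro eq_vecI) (auto simp: M_def)
    moreover have "row M r \<bullet> c = 0"
      using arg_cong[OF c(3), of "\<lambda>u. u $ r"] r J M by simp
    ultimately show "(Y *\<^sub>v c) $ i = 0" using i Y by simp
  qed
qed

text \<open>
  The half of the Courant--Fischer theorem that bounds eigenvalues from below. The eigenvectors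
  with eigenvalue at least \<open>\<theta>\<close> impose that many linear conditions; if there were fewer than \<open>t\<close>
  of them, some nonzero vector of the \<open>t\<close>-dimensional range of \<open>X\<close> would be orthogonal to all of
  them, so it would be a combination of eigenvectors with eigenvalue below \<open>\<theta>\<close> and have Rayleigh
  quotient below \<open>\<theta>\<close>.
\<close>

theorem rayleigh_subspace_eigenvalue_count:
  fixes A X :: "real mat"
  assumes A: "A \<in> carrier_mat n n" "transpose_mat A = A"
    and X: "X \<in> carrier_mat n t"
    and inj: "\<And>c. c \<in> carrier_vec t \<Longrightarrow> c \<noteq> 0\<^sub>v t \<Longrightarrow> X *\<^sub>v c \<noteq> 0\<^sub>v n"
    and ge: "\<And>c. c \<in> carrier_vec t \<Longrightarrow>
      (X *\<^sub>v c) \<bullet> (A *\<^sub>v (X *\<^sub>v c)) \<ge> \<theta> * ((X *\<^sub>v c) \<bullet> (X *\<^sub>v c))"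
  shows "t \<le> size (filter_mset (\<lambda>e. \<theta> \<le> e) (proots (char_poly A)))"
proof -
  obtain P D where P: "P \<in> carrier_mat n n" and D: "D \<in> carrier_mat n n" "diagonal_mat D"
    and PP: "transpose_mat P * P = 1\<^sub>m n" and dec: "A = P * D * transpose_mat P"
    using real_symmetric_diagonalization[OF A] by blast
  have PP': "P * transpose_mat P = 1\<^sub>m n"
    using mat_mult_left_right_inverse[OF _ P PP] P by simp
  have "similar_mat A D"
    by (rule similar_matI[of _ _ P "transpose_mat P" n]) (use A P D PP PP' dec in auto)
  then have roots: "proots (char_poly A) = mset (diag_mat D)"
    using char_poly_similar diagonal_char_poly_proots[OF D] by metis
  define J where "J = {i. i < n \<and> \<theta> \<le> D $$ (i, i)}"
  have "size (filter_mset (\<lambda>e. \<theta> \<le> e) (mset (diag_mat D)))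
      = length (filter (\<lambda>e. \<theta> \<le> e) (diag_mat D))"
    by (metis mset_filter size_mset)
  also have "\<dots> = length (filter (\<lambda>i. \<theta> \<le> D $$ (i, i)) [0..<n])"
    using D(1) by (simp add: diag_mat_def filter_map o_def)
  also have "\<dots> = card J"
    unfolding J_def by (subst distinct_card[symmetric]) (auto intro!: arg_cong[of _ _ card])
  finally have card_J: "size (filter_mset (\<lambda>e. \<theta> \<le> e) (proots (char_poly A))) = card J"
    by (simp add: roots)
  show ?thesis
  proof (rule ccontr)
    assume "\<not> ?thesis"
    then have "card J < t" using card_J by simp
    define Y where "Y = transpose_mat P * X"
    have Y: "Y \<in> carrier_mat n t" using P X by (simp add: Y_def)
    obtain c where c: "c \<in> carrier_vec t" "c \<noteq> 0\<^sub>v t" "\<And>i. i \<in> J \<Longrightarrow> (Y *\<^sub>v c) $ i = 0"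
      using underdetermined_system_nontrivial_solution[OF Y _ \<open>card J < t\<close>]
      by (auto simp: J_def)
    define z where "z = X *\<^sub>v c"
    define y where "y = transpose_mat P *\<^sub>v z"
    have z: "z \<in> carrier_vec n" and y: "y \<in> carrier_vec n"
      using X P c(1) by (auto simp: z_def y_def)
    have "y = Y *\<^sub>v c"
      unfolding y_def z_def Y_def using P X c(1) by (simp add: assoc_mult_mat_vec[of _ n n _ t])
    then have y0: "y $ i = 0" if "i < n" "\<theta> \<le> D $$ (i, i)" for i
      using c(3) that by (simp add: J_def)
    have zy: "z = P *\<^sub>v y"
      unfolding y_def using P z PP' by (simp flip: assoc_mult_mat_vec[of _ n n _ n])
    have "y \<noteq> 0\<^sub>v n"
    proof
      assume "y = 0\<^sub>v n"
      then have "z = 0\<^sub>v n" unfolding zy using P by (intro eq_vecI) auto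
      then show False using inj[OF c(1,2)] by (simp add: z_def)
    qed
    then obtain i where i: "i < n" "y $ i \<noteq> 0" using y by (metis carrier_vecD eq_vecI index_zero_vec)
    have "z \<bullet> z = y \<bullet> y"
      using transpose_vec_mult_scalar[OF P y z] y_def zy[symmetric] by simp
    also have "\<dots> = (\<Sum>i<n. y $ i * y $ i)"
      using y by (simp add: scalar_prod_def lessThan_atLeast0)
    finally have zz: "z \<bullet> z = (\<Sum>i<n. y $ i * y $ i)" .
    have Dy: "D *\<^sub>v y = vec n (\<lambda>i. D $$ (i, i) * y $ i)"
    proof (rule eq_vecI)
      fix i assume "i < dim_vec (vec n (\<lambda>i. D $$ (i, i) * y $ i))"
      then have i: "i < n" by simp
      have "(D *\<^sub>v y) $ i = (\<Sum>j<n. D $$ (i, j) * y $ j)"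
        using i D y by (simp add: scalar_prod_def lessThan_atLeast0)
      also have "\<dots> = (\<Sum>j<n. if j = i then D $$ (i, i) * y $ i else 0)"
        by (rule sum.cong) (use D i in \<open>auto simp: diagonal_mat_def\<close>)
      finally show "(D *\<^sub>v y) $ i = vec n (\<lambda>i. D $$ (i, i) * y $ i) $ i" using i by simp
    qed (use D in auto)
    have "A *\<^sub>v z = P *\<^sub>v (D *\<^sub>v y)"
      unfolding dec y_def using P D z by (simp add: assoc_mult_mat_vec[of _ n n _ n])
    then have "z \<bullet> (A *\<^sub>v z) = y \<bullet> (D *\<^sub>v y)"
      using transpose_vec_mult_scalar[OF P _ z, of "D *\<^sub>v y"] D y y_def by simp
    also have "\<dots> = (\<Sum>i<n. D $$ (i, i) * (y $ i * y $ i))"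
      using y by (simp add: Dy scalar_prod_def lessThan_atLeast0 mult.left_commute)
    also have "\<dots> < (\<Sum>i<n. \<theta> * (y $ i * y $ i))"
    proof (rule sum_strict_mono_ex1)
      show "\<forall>i\<in>{..<n}. D $$ (i, i) * (y $ i * y $ i) \<le> \<theta> * (y $ i * y $ i)"
      proof
        fix i assume "i \<in> {..<n}"
        then show "D $$ (i, i) * (y $ i * y $ i) \<le> \<theta> * (y $ i * y $ i)"
          using y0[of i] by (cases "\<theta> \<le> D $$ (i, i)") (auto intro!: mult_right_mono)
      qed
      have "D $$ (i, i) * (y $ i * y $ i) < \<theta> * (y $ i * y $ i)"
      proof (rule mult_strict_right_mono)
        show "D $$ (i, i) < \<theta>" using y0[of i] i by force
        show "0 < y $ i * y $ i" using i by (auto simp: zero_less_mult_iff linorder_neq_iff)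
      qed
      then show "\<exists>i\<in>{..<n}. D $$ (i, i) * (y $ i * y $ i) < \<theta> * (y $ i * y $ i)"
        using i by auto
    qed simp
    also have "\<dots> = \<theta> * (z \<bullet> z)" by (simp add: zz sum_distrib_left)
    finally show False using ge[OF c(1)] by (simp add: z_def)
  qed
qed

lemma nth_of_decreasing_ge:
  fixes M :: "real multiset"
  assumes "i < size (filter_mset (\<lambda>e. \<theta> \<le> e) M)"
  shows "\<theta> \<le> rev (sorted_list_of_multiset M) ! i"
proof (rule ccontr)
  define xs where "xs = rev (sorted_list_of_multiset M)"
  assume "\<not> ?thesis"
  then have lt: "xs ! i < \<theta>" by (simp add: xs_def)
  have sorted: "sorted (rev xs)" and M: "mset xs = M" by (simp_all add: xs_def)
  have "size (filter_mset (\<lambda>e. \<theta> \<le> e) M) = card {j. j < length xs \<and> \<theta> \<le> xs ! j}"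
    unfolding M[symmetric] by (simp add: length_filter_conv_card flip: mset_filter)
  also have "\<dots> \<le> card {..<i}"
  proof (rule card_mono)
    show "{j. j < length xs \<and> \<theta> \<le> xs ! j} \<subseteq> {..<i}"
    proof safe
      fix j assume j: "j < length xs" "\<theta> \<le> xs ! j"
      show "j < i"
      proof (rule ccontr)
        assume "\<not> j < i"
        then have "xs ! j \<le> xs ! i"
          using sorted_rev_nth_mono[OF sorted] j by auto
        then show False using j lt by simp
      qed
    qed
  qed simp
  finally show False using assms by simp
qed

section \<open>Near-regular vertex sets have a large Rayleigh quotient\<close>

text \<open>
  This is the characteristic equation of the matrix with rows \<open>(r - 1, d + 1 - r)\<close> and
  \<open>(r, d - r - 1)\<close>, the quotient matrix of the complete graph on \<open>d + 1\<close> vertices minus a perfect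
  matching on all but \<open>r\<close> of its vertices (for integers with \<open>d + 1 - r\<close> even).
\<close>

lemma threshold_quadratic_equation:
  fixes d r :: real
  assumes "d\<^sup>2 + 4 * r \<ge> 0"
  defines "\<theta> \<equiv> (d - 2 + sqrt (d\<^sup>2 + 4 * r)) / 2"
  shows "\<theta>\<^sup>2 = (d - 2) * \<theta> + (d + r - 1)"
proof -
  define s where "s = sqrt (d\<^sup>2 + 4 * r)"
  have "s\<^sup>2 = d\<^sup>2 + 4 * r" using assms by (simp add: s_def)
  moreover have "s = 2 * \<theta> - d + 2" unfolding \<theta>_def s_def[symmetric] by (simp add: field_simps)
  ultimately have "(2 * \<theta> - d + 2)\<^sup>2 = d\<^sup>2 + 4 * r" by simp
  then show ?thesis by (simp add: power2_eq_square algebra_simps)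
qed

text \<open>
  A set of \<open>m\<close> vertices of a \<open>d\<close>-regular graph that is left by at most \<open>d + 1 - r\<close> edges has
  average inner degree at least \<open>d - (d + 1 - r) / m\<close>; the inequality says that \<open>m = d + 2\<close>
  already lifts this to the threshold. With \<open>s = (d + 1 - r) / (d + 2)\<close> it is equivalent to
  \<open>d\<^sup>2 + 4 r \<le> (d + 2 - 2 s)\<^sup>2\<close>, where the two sides differ by exactly \<open>4 s\<^sup>2\<close>.
\<close>

lemma threshold_below_average_degree:
  fixes d r :: real
  assumes "2 \<le> r" "r \<le> d"
  defines "\<theta> \<equiv> (d - 2 + sqrt (d\<^sup>2 + 4 * r)) / 2"
  shows "(d - \<theta>) * (d + 2) \<ge> d + 1 - r" "\<theta> \<le> d"
proof -
  define s where "s = (d + 1 - r) / (d + 2)"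
  have s: "s * (d + 2) = d + 1 - r" "0 \<le> s" "s \<le> 1" using assms by (auto simp: s_def field_simps)
  have "sqrt (d\<^sup>2 + 4 * r) \<le> d + 2 - 2 * s"
  proof (rule real_le_lsqrt)
    have "(d + 2 - 2 * s)\<^sup>2 = (d + 2)\<^sup>2 - 4 * (s * (d + 2)) + 4 * s\<^sup>2"
      by (simp add: power2_eq_square algebra_simps)
    also have "\<dots> = d\<^sup>2 + 4 * r + 4 * s\<^sup>2"
      unfolding s(1) by (simp add: power2_eq_square algebra_simps)
    finally show "d\<^sup>2 + 4 * r \<le> (d + 2 - 2 * s)\<^sup>2" by simp
  qed (use assms s in auto)
  then have th: "\<theta> \<le> d - s" by (simp add: \<theta>_def field_simps)
  then show "\<theta> \<le> d" using s by simp
  have "s * (d + 2) \<le> (d - \<theta>) * (d + 2)"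
    using th assms(1,2) by (intro mult_right_mono) auto
  then show "(d - \<theta>) * (d + 2) \<ge> d + 1 - r" using s by simp
qed

lemma double_sum_of_bool:
  fixes g :: "'a \<Rightarrow> 'a \<Rightarrow> real"
  assumes "finite C"
  shows "(\<Sum>u\<in>C. \<Sum>v\<in>C. of_bool ((u, v) \<in> E) * g u v) = (\<Sum>(u, v)\<in>E \<inter> C \<times> C. g u v)"
proof -
  have "(\<Sum>u\<in>C. \<Sum>v\<in>C. of_bool ((u, v) \<in> E) * g u v)
      = (\<Sum>p\<in>C \<times> C. if p \<in> E then g (fst p) (snd p) else 0)"
    by (subst sum.cartesian_product) (auto intro!: sum.cong)
  also have "\<dots> = (\<Sum>p\<in>C \<times> C \<inter> E. g (fst p) (snd p))"
    using assms by (simp add: sum.If_cases Int_def[symmetric])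
  finally show ?thesis by (simp add: case_prod_unfold Int_commute)
qed

text \<open>
  If \<open>E\<close> is the adjacency relation of a \<open>d\<close>-regular graph, the hypothesis \<open>few\<close> says that at
  most \<open>d + 1 - r\<close> edges leave \<open>C\<close>. Such a set cannot have \<open>d\<close> or fewer vertices, since \<open>m \<le> d\<close>
  vertices send out at least \<open>m (d - m + 1) \<ge> d\<close> edges. If it has at least \<open>d + 2\<close> vertices, the
  constant function works, because its Rayleigh quotient is the average degree. If it has exactly
  \<open>d + 1\<close> vertices, at most \<open>d + 1 - r\<close> ordered pairs are missing from the complete graph, so at
  least \<open>r\<close> vertices are joined to all others. The function with one value on \<open>r\<close> of these and
  another on the rest, taken from the eigenvector of the quotient matrix of the extremal graph,
  has Rayleigh quotient at least the eigenvalue of that matrix.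
\<close>

lemma near_regular_set_test_function:
  fixes E :: "('a \<times> 'a) set" and d r :: nat
  assumes C: "finite C" "C \<noteq> {}" and E: "sym E" "irrefl E" and r: "2 \<le> r" "r \<le> d"
    and few: "d * card C \<le> card (E \<inter> C \<times> C) + (d + 1 - r)"
  defines "\<theta> \<equiv> (real d - 2 + sqrt ((real d)\<^sup>2 + 4 * real r)) / 2"
  shows "\<exists>f. 0 < (\<Sum>u\<in>C. (f u)\<^sup>2) \<and>
    \<theta> * (\<Sum>u\<in>C. (f u)\<^sup>2) \<le> (\<Sum>u\<in>C. \<Sum>v\<in>C. of_bool ((u, v) \<in> E) * (f u * f v))"
proof -
  define m where "m = card C"
  define q where "q = real d + 1 - real r"
  have m: "m \<ge> 1" using C by (simp add: m_def Suc_leI card_gt_0_iff)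
  define e2 where "e2 = card (E \<inter> C \<times> C)"
  have few': "real d * real m \<le> real e2 + q"
    using few r unfolding e2_def m_def q_def by (simp flip: of_nat_mult of_nat_add)
  define M where "M = {(u, v). u \<in> C \<and> v \<in> C \<and> u \<noteq> v \<and> (u, v) \<notin> E}"
  have finM: "finite M" by (rule finite_subset[of _ "C \<times> C"]) (use C in \<open>auto simp: M_def\<close>)
  have split: "C \<times> C = (E \<inter> C \<times> C) \<union> M \<union> (\<lambda>u. (u, u)) ` C"
    by (auto simp: M_def)
  have "card (C \<times> C) = e2 + card M + m"
  proof -
    have "card ((E \<inter> C \<times> C) \<union> M \<union> (\<lambda>u. (u, u)) ` C)
        = card ((E \<inter> C \<times> C) \<union> M) + card ((\<lambda>u. (u, u)) ` C)"
      by (rule card_Un_disjoint) (use C finM E in \<open>auto simp: M_def irrefl_def\<close>)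
    also have "card ((E \<inter> C \<times> C) \<union> M) = e2 + card M"
      unfolding e2_def by (rule card_Un_disjoint) (use C finM in \<open>auto simp: M_def\<close>)
    also have "card ((\<lambda>u. (u, u)) ` C) = m"
      unfolding m_def by (rule card_image) (auto simp: inj_on_def)
    finally show ?thesis using split by simp
  qed
  then have mm: "real m * real m = real e2 + real (card M) + real m"
    using C by (simp add: m_def card_cartesian_product flip: of_nat_mult of_nat_add)
  consider "m \<le> d" | "m = d + 1" | "m \<ge> d + 2" by linarith
  then show ?thesis
  proof cases
    case 1
    \<comment> \<open>Each vertex of \<open>C\<close> has at most \<open>m - 1\<close> neighbours in \<open>C\<close>; the two inequalities contradict each
      other because \<open>q < d\<close>.\<close>
    have "real d * real m \<le> real m * real m - real m + q" using few' mm by linarith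
    moreover have "(real m - 1) * (real d - real m) \<ge> 0" using 1 m by simp
    ultimately show ?thesis using r by (simp add: q_def algebra_simps)
  next
    case 3
    have "q \<le> (real d - \<theta>) * (real d + 2)"
      unfolding q_def \<theta>_def by (rule threshold_below_average_degree) (use r in auto)
    also have "\<dots> \<le> (real d - \<theta>) * real m"
    proof (rule mult_left_mono)
      show "real d - \<theta> \<ge> 0" unfolding \<theta>_def using threshold_below_average_degree(2)[of "real r" "real d"] r by simp
    qed (use 3 in simp)
    finally have "\<theta> * real m \<le> real e2" using few' by (simp add: algebra_simps)
    moreover have "(\<Sum>u\<in>C. \<Sum>v\<in>C. of_bool ((u, v) \<in> E) * (1::real)) = real e2"
      unfolding double_sum_of_bool[OF C(1), of E "\<lambda>_ _. 1"] by (simp add: e2_def)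
    ultimately show ?thesis
      using m by (intro exI[of _ "\<lambda>_. 1"]) (simp add: m_def)
  next
    case 2
    have M_le: "real (card M) \<le> q"
      using mm few' unfolding 2 by (simp add: algebra_simps)
    have "card (C - fst ` M) \<ge> r"
    proof -
      have "card (fst ` M) \<le> card M" by (rule card_image_le[OF finM])
      moreover have "card (C - fst ` M) = m - card (fst ` M)"
        unfolding m_def by (rule card_Diff_subset) (use finM in \<open>auto simp: M_def\<close>)
      ultimately show ?thesis using M_le r 2 unfolding q_def by linarith
    qed
    then obtain W where W: "W \<subseteq> C - fst ` M" "card W = r" "finite W"
      using obtain_subset_with_card_n by metis
    have WC: "W \<subseteq> C" using W by auto
    \<comment> \<open>The value for which \<open>(a, 1)\<close> is an eigenvector of the quotient matrix: \<open>ev1\<close> below is its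
      first row, and \<open>ra\<close> its second.\<close>
    define a where "a = (\<theta> - q + 2) / real r"
    define f where "f u = (if u \<in> W then a else 1)" for u
    have sum_split: "(\<Sum>u\<in>C. h (f u)) = real r * h a + q * h 1" for h :: "real \<Rightarrow> real"
    proof -
      have "(\<Sum>u\<in>C. h (f u)) = (\<Sum>u\<in>C - W. h (f u)) + (\<Sum>u\<in>W. h (f u))"
        by (rule sum.subset_diff) (use WC C in auto)
      also have "(\<Sum>u\<in>W. h (f u)) = real r * h a" using W by (simp add: f_def)
      also have "(\<Sum>u\<in>C - W. h (f u)) = real (card (C - W)) * h 1" by (simp add: f_def)
      also have "real (card (C - W)) = q"
        using W r 2 WC C by (subst card_Diff_subset) (auto simp: q_def m_def)
      finally show ?thesis by simp
    qed
    have quad: "(\<Sum>u\<in>C. \<Sum>v\<in>C. of_bool ((u, v) \<in> E) * (f u * f v))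
        = (real r * a + q)\<^sup>2 - (real r * a\<^sup>2 + q) - real (card M)"
    proof -
      have "(\<Sum>u\<in>C. \<Sum>v\<in>C. of_bool ((u, v) \<in> E) * (f u * f v))
          = (\<Sum>u\<in>C. \<Sum>v\<in>C. f u * f v - (if u = v then f u * f v else 0)
              - of_bool ((u, v) \<in> M) * (f u * f v))"
        by (intro sum.cong refl) (use E in \<open>auto simp: M_def irrefl_def\<close>)
      also have "\<dots> = (\<Sum>u\<in>C. \<Sum>v\<in>C. f u * f v) - (\<Sum>u\<in>C. f u * f u)
          - (\<Sum>u\<in>C. \<Sum>v\<in>C. of_bool ((u, v) \<in> M) * (f u * f v))"
        using C by (simp add: sum_subtractf)
      also have "(\<Sum>u\<in>C. \<Sum>v\<in>C. f u * f v) = (\<Sum>u\<in>C. f u)\<^sup>2"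
        by (simp add: power2_eq_square sum_product)
      also have "(\<Sum>u\<in>C. f u) = real r * a + q" using sum_split[of "\<lambda>x. x"] by simp
      also have "(\<Sum>u\<in>C. f u * f u) = real r * a\<^sup>2 + q"
        using sum_split[of "\<lambda>x. x * x"] by (simp add: power2_eq_square)
      also have "(\<Sum>u\<in>C. \<Sum>v\<in>C. of_bool ((u, v) \<in> M) * (f u * f v))
          = (\<Sum>(u, v)\<in>M \<inter> C \<times> C. f u * f v)"
        by (rule double_sum_of_bool[OF C(1)])
      \<comment> \<open>A missing pair has no end in \<open>W\<close>, so the test function is 1 at both ends.\<close>
      also have "\<dots> = (\<Sum>p\<in>M. 1)"
      proof (rule sum.cong)
        fix p assume "p \<in> M"
        then obtain u v where p: "p = (u, v)" "(u, v) \<in> M" "(v, u) \<in> M"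
          using E by (auto simp: M_def sym_def)
        then have "u \<in> fst ` M" "v \<in> fst ` M" by force+
        then show "(case p of (u, v) \<Rightarrow> f u * f v) = 1" using p W by (auto simp: f_def)
      qed (auto simp: M_def)
      finally show ?thesis by simp
    qed
    have theta: "\<theta>\<^sup>2 = (real d - 2) * \<theta> + (real d + real r - 1)"
      unfolding \<theta>_def by (rule threshold_quadratic_equation) simp
    have ra: "real r * a = \<theta> - q + 2" using r by (simp add: a_def)
    have "real r * ((real r - 1) * a + q) = (real r - 1) * (\<theta> - q + 2) + real r * q"
      unfolding ra[symmetric] by (simp add: algebra_simps)
    also have "\<dots> = \<theta> * (\<theta> - q + 2)"
      using theta unfolding q_def by (simp add: power2_eq_square algebra_simps)
    also have "\<dots> = real r * (\<theta> * a)" unfolding ra[symmetric] by simp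
    finally have ev1: "(real r - 1) * a + q = \<theta> * a" using r by simp
    have "(real r * a + q)\<^sup>2 - (real r * a\<^sup>2 + q) - q
        = real r * a * ((real r - 1) * a + q) + q * (real r * a + q - 2)"
      by (simp add: power2_eq_square algebra_simps)
    also have "\<dots> = real r * a * (\<theta> * a) + q * \<theta>"
      unfolding ev1 by (simp add: ra)
    also have "\<dots> = \<theta> * (real r * a\<^sup>2 + q)"
      by (simp add: power2_eq_square algebra_simps)
    finally have "\<theta> * (real r * a\<^sup>2 + q)
        \<le> (\<Sum>u\<in>C. \<Sum>v\<in>C. of_bool ((u, v) \<in> E) * (f u * f v))"
      unfolding quad using M_le by simp
    moreover have "(\<Sum>u\<in>C. (f u)\<^sup>2) = real r * a\<^sup>2 + q"
      using sum_split[of "\<lambda>x. x\<^sup>2"] by simp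
    moreover have "q > 0" using r by (simp add: q_def)
    ultimately show ?thesis by (intro exI[of _ f]) (simp add: add_nonneg_pos)
  qed
qed

lemma even_card_symmetric_irreflexive:
  assumes "finite C" "sym E" "irrefl E"
  shows "even (card (E \<inter> C \<times> C))"
  using assms(1)
proof induction
  case (insert x C)
  define N where "N = {v \<in> C. (x, v) \<in> E}"
  have fin: "finite N" using insert by (simp add: N_def)
  have "E \<inter> insert x C \<times> insert x C = (E \<inter> C \<times> C) \<union> (Pair x ` N \<union> (\<lambda>v. (v, x)) ` N)"
    using assms(2,3) insert(2) by (auto simp: N_def sym_def irrefl_def)
  also have "card \<dots> = card (E \<inter> C \<times> C) + card (Pair x ` N \<union> (\<lambda>v. (v, x)) ` N)"
    by (rule card_Un_disjoint) (use insert fin in \<open>auto simp: N_def\<close>)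
  also have "card (Pair x ` N \<union> (\<lambda>v. (v, x)) ` N) = card (Pair x ` N) + card ((\<lambda>v. (v, x)) ` N)"
    by (rule card_Un_disjoint) (use insert fin in \<open>auto simp: N_def\<close>)
  also have "card (Pair x ` N) = card N" by (rule card_image) (auto simp: inj_on_def)
  also have "card ((\<lambda>v. (v, x)) ` N) = card N" by (rule card_image) (auto simp: inj_on_def)
  finally show ?case using insert by simp
qed simp

section \<open>Graph eigenvalues from separated test functions\<close>

lemma vertex_list_enumerates:
  assumes "finite (verts G)"
  shows "distinct (vertex_list G)" "set (vertex_list G) = verts G"
proof -
  have "distinct (vertex_list G) \<and> set (vertex_list G) = verts G"
    unfolding vertex_list_def by (rule someI_ex) (use finite_distinct_list[OF assms] in blast)
  then show "distinct (vertex_list G)" "set (vertex_list G) = verts G" by auto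
qed

text \<open>
  Expanding the form on a combination of functions that are pairwise orthogonal for every single
  entry of \<open>B\<close> leaves only the diagonal terms. It serves both for the adjacency form and for the
  Euclidean norm.
\<close>

lemma form_of_orthogonal_combination:
  fixes B :: "'a \<Rightarrow> 'a \<Rightarrow> real" and F :: "'i \<Rightarrow> 'a \<Rightarrow> real"
  assumes fin: "finite I"
    and orth: "\<And>i j u v. i \<in> I \<Longrightarrow> j \<in> I \<Longrightarrow> i \<noteq> j \<Longrightarrow> B u v * (F i u * F j v) = 0"
  shows "(\<Sum>u\<in>V. \<Sum>v\<in>V. B u v * ((\<Sum>i\<in>I. c i * F i u) * (\<Sum>i\<in>I. c i * F i v)))
    = (\<Sum>i\<in>I. (c i)\<^sup>2 * (\<Sum>u\<in>V. \<Sum>v\<in>V. B u v * (F i u * F i v)))"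
proof -
  have pt: "B u v * ((\<Sum>i\<in>I. c i * F i u) * (\<Sum>i\<in>I. c i * F i v))
      = (\<Sum>i\<in>I. (c i)\<^sup>2 * (B u v * (F i u * F i v)))" for u v
  proof -
    have "B u v * ((\<Sum>i\<in>I. c i * F i u) * (\<Sum>i\<in>I. c i * F i v))
        = (\<Sum>i\<in>I. \<Sum>j\<in>I. c i * c j * (B u v * (F i u * F j v)))"
      unfolding sum_product by (simp add: sum_distrib_left mult.assoc mult.left_commute)
    also have "\<dots> = (\<Sum>i\<in>I. \<Sum>j\<in>I. if j = i then (c i)\<^sup>2 * (B u v * (F i u * F i v)) else 0)"
      by (intro sum.cong refl) (use orth in \<open>auto simp: power2_eq_square\<close>)
    finally show ?thesis using fin by simp
  qed
  show ?thesis
    unfolding pt by (simp only: sum_distrib_left sum.swap[of _ I V])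
qed

text \<open>
  Test functions on disjoint sets with no edges between them are orthogonal both for the inner
  product and for the adjacency form, so the Rayleigh quotient on their span is a weighted mean of
  theirs and stays at least \<open>\<theta>\<close>. Their span has dimension \<open>t\<close>, so at least \<open>t\<close> eigenvalues
  are at least \<open>\<theta>\<close>. This replaces interlacing for the induced subgraphs on the sets.
\<close>

theorem separated_test_functions_eigenvalue:
  fixes G :: "('a, 'b) pre_digraph" and C :: "nat \<Rightarrow> 'a set"
  assumes G: "graph G"
    and C: "\<And>i. i < t \<Longrightarrow> C i \<subseteq> verts G"
    and disj: "\<And>i j. i < t \<Longrightarrow> j < t \<Longrightarrow> i \<noteq> j \<Longrightarrow> C i \<inter> C j = {}"
    and nonadj: "\<And>i j u v. i < t \<Longrightarrow> j < t \<Longrightarrow> i \<noteq> j \<Longrightarrow> u \<in> C i \<Longrightarrow> v \<in> C j \<Longrightarrow> (u, v) \<notin> arcs_ends G"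
    and pos: "\<And>i. i < t \<Longrightarrow> 0 < (\<Sum>u\<in>C i. (f i u)\<^sup>2)"
    and ray: "\<And>i. i < t \<Longrightarrow> \<theta> * (\<Sum>u\<in>C i. (f i u)\<^sup>2)
      \<le> (\<Sum>u\<in>C i. \<Sum>v\<in>C i. of_bool ((u, v) \<in> arcs_ends G) * (f i u * f i v))"
    and T: "1 \<le> T" "T \<le> t"
  shows "\<theta> \<le> graph_eigenvalue G T"
proof -
  interpret graph G by fact
  define V where "V = verts G"
  have finV: "finite V" by (simp add: V_def)
  define vs where "vs = vertex_list G"
  have vs: "distinct vs" "set vs = V"
    using vertex_list_enumerates[of G] finV by (auto simp: vs_def V_def)
  define n where "n = length vs"
  have bij: "bij_betw ((!) vs) {..<n} V"
    using bij_betw_nth[OF vs(1), of "{..<n}" V] vs(2) by (simp add: n_def)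
  define A where "A = adjacency_matrix G"
  have A_def': "A = mat n n (\<lambda>(i, j). of_bool ((vs ! i, vs ! j) \<in> arcs_ends G))"
    unfolding A_def adjacency_matrix_def Let_def vs_def[symmetric] n_def[symmetric]
    by (rule eq_matI) auto
  have A: "A \<in> carrier_mat n n" by (simp add: A_def')
  have symA: "transpose_mat A = A"
    by (rule eq_matI) (use graph_symmetric in \<open>auto simp: A_def'\<close>)
  define F where "F i u = (if u \<in> C i then f i u else 0)" for i u
  define X where "X = mat n t (\<lambda>(a, i). F i (vs ! a))"
  have X: "X \<in> carrier_mat n t" by (simp add: X_def)
  define g where "g c u = (\<Sum>i<t. c $ i * F i u)" for c :: "real vec" and u
  have Xc: "(X *\<^sub>v c) $ a = g c (vs ! a)" if "c \<in> carrier_vec t" "a < n" for c a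
    using that by (simp add: X_def g_def scalar_prod_def lessThan_atLeast0 mult.commute)
  have restrict: "(\<Sum>u\<in>V. \<Sum>v\<in>V. B u v * (F i u * F i v))
      = (\<Sum>u\<in>C i. \<Sum>v\<in>C i. B u v * (f i u * f i v))" if "i < t" for B i
  proof -
    have "(\<Sum>u\<in>V. \<Sum>v\<in>V. B u v * (F i u * F i v)) = (\<Sum>u\<in>C i. \<Sum>v\<in>V. B u v * (F i u * F i v))"
      by (rule sum.mono_neutral_right) (use finV C[OF that] in \<open>auto simp: V_def F_def\<close>)
    also have "\<dots> = (\<Sum>u\<in>C i. \<Sum>v\<in>C i. B u v * (F i u * F i v))"
      by (intro sum.cong refl sum.mono_neutral_right)
        (use finV C[OF that] in \<open>auto simp: V_def F_def\<close>)
    finally show ?thesis by (simp add: F_def)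
  qed
  have norm: "(X *\<^sub>v c) \<bullet> (X *\<^sub>v c) = (\<Sum>i<t. (c $ i)\<^sup>2 * (\<Sum>u\<in>C i. (f i u)\<^sup>2))"
    if c: "c \<in> carrier_vec t" for c
  proof -
    have "(X *\<^sub>v c) \<bullet> (X *\<^sub>v c) = (\<Sum>a<n. g c (vs ! a) * g c (vs ! a))"
      using Xc[OF c] X by (simp add: scalar_prod_def lessThan_atLeast0)
    also have "\<dots> = (\<Sum>u\<in>V. g c u * g c u)"
      by (rule sum.reindex_bij_betw[OF bij])
    also have "\<dots> = (\<Sum>u\<in>V. \<Sum>v\<in>V. of_bool (u = v) * (g c u * g c v))"
      using finV by (intro sum.cong refl) (simp add: of_bool_def if_distrib[of "\<lambda>x. x * _"] cong: if_cong)
    also have "\<dots> = (\<Sum>i<t. (c $ i)\<^sup>2 * (\<Sum>u\<in>V. \<Sum>v\<in>V. of_bool (u = v) * (F i u * F i v)))"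
      unfolding g_def
      by (rule form_of_orthogonal_combination) (use disj in \<open>auto simp: F_def\<close>)
    also have "\<dots> = (\<Sum>i<t. (c $ i)\<^sup>2 * (\<Sum>u\<in>C i. (f i u)\<^sup>2))"
    proof (intro sum.cong refl)
      fix i assume "i \<in> {..<t}"
      then have i: "i < t" "finite (C i)" using C[of i] finV by (auto simp: V_def intro: finite_subset)
      then show "(c $ i)\<^sup>2 * (\<Sum>u\<in>V. \<Sum>v\<in>V. of_bool (u = v) * (F i u * F i v))
          = (c $ i)\<^sup>2 * (\<Sum>u\<in>C i. (f i u)\<^sup>2)"
        unfolding restrict[OF i(1)]
        by (simp add: of_bool_def if_distrib[of "\<lambda>x. x * _"] power2_eq_square cong: if_cong)
    qed
    finally show ?thesis .
  qed
  have quad: "(X *\<^sub>v c) \<bullet> (A *\<^sub>v (X *\<^sub>v c)) = (\<Sum>i<t. (c $ i)\<^sup>2 *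
      (\<Sum>u\<in>C i. \<Sum>v\<in>C i. of_bool ((u, v) \<in> arcs_ends G) * (f i u * f i v)))"
    if c: "c \<in> carrier_vec t" for c
  proof -
    have "(A *\<^sub>v (X *\<^sub>v c)) $ a
        = (\<Sum>b<n. of_bool ((vs ! a, vs ! b) \<in> arcs_ends G) * g c (vs ! b))" if "a < n" for a
      using that Xc[OF c] X A by (simp add: A_def' scalar_prod_def lessThan_atLeast0)
    then have "(X *\<^sub>v c) \<bullet> (A *\<^sub>v (X *\<^sub>v c)) = (\<Sum>a<n. g c (vs ! a) *
        (\<Sum>b<n. of_bool ((vs ! a, vs ! b) \<in> arcs_ends G) * g c (vs ! b)))"
      using Xc[OF c] X A by (simp add: scalar_prod_def lessThan_atLeast0)
    also have "\<dots> = (\<Sum>a<n. g c (vs ! a) *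
        (\<Sum>v\<in>V. of_bool ((vs ! a, v) \<in> arcs_ends G) * g c v))"
      by (intro sum.cong refl arg_cong[of _ _ "(*) _"] sum.reindex_bij_betw[OF bij])
    also have "\<dots> = (\<Sum>u\<in>V. g c u * (\<Sum>v\<in>V. of_bool ((u, v) \<in> arcs_ends G) * g c v))"
      by (rule sum.reindex_bij_betw[OF bij])
    also have "\<dots> = (\<Sum>u\<in>V. \<Sum>v\<in>V. of_bool ((u, v) \<in> arcs_ends G) * (g c u * g c v))"
      by (simp add: sum_distrib_left mult.left_commute)
    also have "\<dots> = (\<Sum>i<t. (c $ i)\<^sup>2 *
        (\<Sum>u\<in>V. \<Sum>v\<in>V. of_bool ((u, v) \<in> arcs_ends G) * (F i u * F i v)))"
      unfolding g_def
      by (rule form_of_orthogonal_combination) (use nonadj in \<open>auto simp: F_def\<close>)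
    finally show ?thesis using restrict by simp
  qed
  have "t \<le> size (filter_mset (\<lambda>e. \<theta> \<le> e) (proots (char_poly A)))"
  proof (rule rayleigh_subspace_eigenvalue_count[OF A symA X])
    fix c :: "real vec" assume c: "c \<in> carrier_vec t"
    have "\<theta> * ((X *\<^sub>v c) \<bullet> (X *\<^sub>v c))
        = (\<Sum>i<t. (c $ i)\<^sup>2 * (\<theta> * (\<Sum>u\<in>C i. (f i u)\<^sup>2)))"
      unfolding norm[OF c] by (subst sum_distrib_left) (simp add: mult.left_commute)
    also have "\<dots> \<le> (X *\<^sub>v c) \<bullet> (A *\<^sub>v (X *\<^sub>v c))"
      unfolding quad[OF c] using ray by (intro sum_mono mult_left_mono) auto
    finally show "\<theta> * ((X *\<^sub>v c) \<bullet> (X *\<^sub>v c)) \<le> (X *\<^sub>v c) \<bullet> (A *\<^sub>v (X *\<^sub>v c))" .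
    assume "c \<noteq> 0\<^sub>v t"
    then obtain i where i: "i < t" "c $ i \<noteq> 0" using c by (metis carrier_vecD eq_vecI index_zero_vec)
    have "0 < (\<Sum>i<t. (c $ i)\<^sup>2 * (\<Sum>u\<in>C i. (f i u)\<^sup>2))"
    proof (rule sum_pos2[of _ i])
      show "0 < (c $ i)\<^sup>2 * (\<Sum>u\<in>C i. (f i u)\<^sup>2)" using i pos[of i] by simp
    qed (use i in \<open>auto intro!: mult_nonneg_nonneg sum_nonneg\<close>)
    then show "X *\<^sub>v c \<noteq> 0\<^sub>v n" using norm[OF c] by auto
  qed
  then show ?thesis
    unfolding graph_eigenvalue_def graph_eigenvalues_def A_def[symmetric]
    using T by (intro nth_of_decreasing_ge) simp
qed

section \<open>Edge boundaries in regular graphs\<close>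

lemma (in graph) card_arcs_from_regular:
  assumes reg: "regular_graph G d" and C: "C \<subseteq> verts G"
  shows "card (arcs_ends G \<inter> C \<times> verts G) = d * card C"
proof -
  have finC: "finite C" using C finite_subset[OF _ finite_verts] by blast
  have "arcs_ends G \<inter> C \<times> verts G = arc_to_ends G ` (\<Union>u\<in>C. out_arcs G u)"
    by (auto simp: arcs_ends_def arc_to_ends_def)
  also have "card \<dots> = card (\<Union>u\<in>C. out_arcs G u)"
    by (rule card_image, rule inj_on_subset[OF inj_on_arc_to_ends]) auto
  also have "\<dots> = (\<Sum>u\<in>C. out_degree G u)"
    unfolding out_degree_def using finC by (intro card_UN_disjoint) auto
  also have "\<dots> = d * card C"
    using reg C by (simp add: regular_graph_def subset_iff)
  finally show ?thesis .
qed

text \<open>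
  Each edge of the cut between \<open>C\<close> and its complement occurs once, as the arc that leaves \<open>C\<close>,
  so the cardinality is the size of the edge cut.
\<close>

definition boundary_arcs :: "('a, 'b) pre_digraph \<Rightarrow> 'a set \<Rightarrow> ('a \<times> 'a) set" where
  "boundary_arcs G C = arcs_ends G \<inter> C \<times> (verts G - C)"

lemma (in graph) finite_boundary_arcs: "finite (boundary_arcs G C)"
  unfolding boundary_arcs_def arcs_ends_def by simp

lemma (in graph) regular_volume_split:
  assumes "regular_graph G d" "C \<subseteq> verts G"
  shows "d * card C = card (arcs_ends G \<inter> C \<times> C) + card (boundary_arcs G C)"
proof -
  have fin: "finite (arcs_ends G)" by (simp add: arcs_ends_def)
  have "arcs_ends G \<inter> C \<times> verts G = (arcs_ends G \<inter> C \<times> C) \<union> boundary_arcs G C"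
    using assms(2) by (auto simp: boundary_arcs_def)
  then have "d * card C = card ((arcs_ends G \<inter> C \<times> C) \<union> boundary_arcs G C)"
    using card_arcs_from_regular[OF assms] by simp
  also have "\<dots> = card (arcs_ends G \<inter> C \<times> C) + card (boundary_arcs G C)"
    by (rule card_Un_disjoint) (use fin in \<open>auto simp: boundary_arcs_def\<close>)
  finally show ?thesis .
qed

text \<open>
  Deleting the edges of the cut disconnects the graph, because no walk can leave \<open>C\<close> any more.
\<close>

lemma (in graph) edge_connectivity_le_boundary:
  assumes C: "C \<subset> verts G" "C \<noteq> {}"
  shows "edge_connectivity G \<le> card (boundary_arcs G C)"
proof -
  define F where "F = (\<lambda>(u, v). {u, v}) ` boundary_arcs G C"
  let ?H = "delete_edges G F"
  have "F \<subseteq> graph_edges G"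
    by (auto simp: F_def boundary_arcs_def graph_edges_def arcs_ends_conv)
  moreover have "\<not> Digraph_Component.connected ?H"
  proof
    assume conn: "Digraph_Component.connected ?H"
    obtain u v where u: "u \<in> C" and v: "v \<in> verts G - C" using C by auto
    have "u \<rightarrow>\<^sup>*\<^bsub>with_proj (mk_symmetric ?H)\<^esub> v"
      using conn u v C unfolding Digraph_Component.connected_def strongly_connected_def
      by (auto simp: delete_edges_def)
    then have "(u, v) \<in> (parcs (mk_symmetric ?H))\<^sup>*"
      by (auto dest: reachable_rtranclI)
    then have "v \<in> C"
    proof (induction rule: rtrancl_induct)
      case (step y z)
      show ?case
      proof (rule ccontr)
        assume "z \<notin> C"
        from step(2) obtain a where a: "a \<in> arcs G" "{tail G a, head G a} \<notin> F"
          "(y, z) = (tail G a, head G a) \<or> (y, z) = (head G a, tail G a)"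
          by (auto simp: parcs_mk_symmetric delete_edges_def)
        have "(tail G a, head G a) \<in> arcs_ends G" using a(1) by (auto simp: arcs_ends_conv)
        then have "(y, z) \<in> arcs_ends G" using a(3) graph_symmetric by auto
        then have "(y, z) \<in> boundary_arcs G C"
          using step(3) \<open>z \<notin> C\<close> adj_in_verts by (auto simp: boundary_arcs_def)
        then have "{y, z} \<in> F" by (auto simp: F_def)
        then show False using a by (auto simp: insert_commute)
      qed
    qed (use u in simp)
    then show False using v by simp
  qed
  ultimately have "edge_connectivity G \<le> card F"
    unfolding edge_connectivity_def by (intro cInf_lower) auto
  also have "\<dots> \<le> card (boundary_arcs G C)"
    unfolding F_def by (rule card_image_le[OF finite_boundary_arcs])
  finally show ?thesis .
qed

text \<open>
  The case distinction on \<open>d\<close> comes from parity: \<open>d |C|\<close> is the size of the cut plus twice the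
  number of edges inside \<open>C\<close>. For even \<open>d\<close> the cut is therefore even, and being less than \<open>d\<close> it
  is at most \<open>d - 2\<close>, which allows \<open>r = 3\<close> in place of \<open>r = 2\<close>.
\<close>

lemma (in graph) regular_small_boundary_test_function:
  assumes reg: "regular_graph G d" and d: "d \<ge> 3"
    and C: "C \<subseteq> verts G" "C \<noteq> {}" and small: "card (boundary_arcs G C) < d"
  shows "\<exists>f. 0 < (\<Sum>u\<in>C. (f u)\<^sup>2) \<and>
    (if even d then (real d - 2 + sqrt ((real d)\<^sup>2 + 12)) / 2
      else (real d - 2 + sqrt ((real d)\<^sup>2 + 8)) / 2) * (\<Sum>u\<in>C. (f u)\<^sup>2)
    \<le> (\<Sum>u\<in>C. \<Sum>v\<in>C. of_bool ((u, v) \<in> arcs_ends G) * (f u * f v))"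
proof -
  have E: "sym (arcs_ends G)" "irrefl (arcs_ends G)"
    using sym_arcs adj_not_same by (auto simp: symmetric_def irrefl_def)
  have finC: "finite C" using C finite_subset[OF _ finite_verts] by blast
  note vol = regular_volume_split[OF reg C(1)]
  define r where "r = (if even d then 3 else 2 :: nat)"
  have "card (boundary_arcs G C) \<le> d + 1 - r"
  proof (cases "even d")
    case True
    then have "even (card (boundary_arcs G C))"
      using vol even_card_symmetric_irreflexive[OF finC E] by (metis even_add even_mult_iff)
    then show ?thesis using small True d unfolding r_def by presburger
  qed (use small in \<open>simp add: r_def\<close>)
  then have "d * card C \<le> card (arcs_ends G \<inter> C \<times> C) + (d + 1 - r)" using vol by simp
  from near_regular_set_test_function[OF finC C(2) E _ _ this] d
  show ?thesis by (auto simp: r_def split: if_splits)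
qed

text \<open>
  Besides being disjoint, the components of \<open>G - S\<close> are such that every edge leaving one of them
  ends in \<open>S\<close>, since an edge to another vertex of \<open>G - S\<close> would enlarge the component.
\<close>

lemma (in graph) vertex_deletion_components:
  assumes H: "H = delete_vertices G S"
  defines "\<C> \<equiv> pre_digraph.sccs_verts H"
  shows "finite \<C>" "card \<C> = card (pre_digraph.sccs H)"
    and "\<And>C. C \<in> \<C> \<Longrightarrow> C \<noteq> {} \<and> C \<subseteq> verts G - S"
    and "\<And>C D. C \<in> \<C> \<Longrightarrow> D \<in> \<C> \<Longrightarrow> C \<noteq> D \<Longrightarrow> C \<inter> D = {}"
    and "\<And>C u v. C \<in> \<C> \<Longrightarrow> u \<in> C \<Longrightarrow> (u, v) \<in> arcs_ends G \<Longrightarrow> v \<in> C \<union> S"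
proof -
  have sub: "induced_subgraph H G"
    unfolding H delete_vertices_def by (rule induced_induce) auto
  interpret H: fin_digraph H
    using sub by (intro fin_digraph_subgraph) auto
  have vH: "verts H = verts G - S" by (simp add: H delete_vertices_def)
  have symH: "symmetric H"
    using sub induced_graph_imp_symmetric sym_arcs by auto
  show "finite \<C>" unfolding \<C>_def by (rule H.finite_sccs_verts)
  show "card \<C> = card (pre_digraph.sccs H)" unfolding \<C>_def by (rule H.card_sccs_verts)
  show *: "C \<noteq> {} \<and> C \<subseteq> verts G - S" if "C \<in> \<C>" for C
    using that H.sccs_verts_subsets[of C] vH unfolding \<C>_def
    by (auto simp: H.in_sccs_verts_conv_reachable)
  show "C \<inter> D = {}" if "C \<in> \<C>" "D \<in> \<C>" "C \<noteq> D" for C D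
    using that H.sccs_verts_disjoint unfolding \<C>_def by blast
  show "v \<in> C \<union> S" if C: "C \<in> \<C>" "u \<in> C" and uv: "(u, v) \<in> arcs_ends G" for C u v
  proof (rule ccontr)
    assume "v \<notin> C \<union> S"
    moreover have "v \<in> verts G" "u \<in> verts G - S" using adj_in_verts[OF uv] *[OF C(1)] C(2) by blast+
    ultimately have "u \<rightarrow>\<^bsub>H\<^esub> v"
      using uv by (auto simp: H delete_vertices_def arcs_ends_conv image_iff)
    then have "u \<rightarrow>\<^sup>*\<^bsub>H\<^esub> v" "v \<rightarrow>\<^sup>*\<^bsub>H\<^esub> u"
      using symmetric_reachable[OF symH] by auto
    then show False using C \<open>v \<notin> C \<union> S\<close> unfolding \<C>_def H.in_sccs_verts_conv_reachable by blast
  qed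
qed

section \<open>The eigenvalue condition for the l-connectivity\<close>

text \<open>
  Every edge leaving one of the sets ends in \<open>S\<close>, and distinct sets use distinct edges; only
  \<open>d |S|\<close> edge ends are available at \<open>S\<close>.
\<close>

lemma (in graph) sum_boundary_components_le:
  assumes reg: "regular_graph G d" and S: "S \<subseteq> verts G" and fin: "finite \<C>"
    and sub: "\<And>C. C \<in> \<C> \<Longrightarrow> C \<subseteq> verts G - S"
    and disj: "\<And>C D. C \<in> \<C> \<Longrightarrow> D \<in> \<C> \<Longrightarrow> C \<noteq> D \<Longrightarrow> C \<inter> D = {}"
    and closed: "\<And>C u v. C \<in> \<C> \<Longrightarrow> u \<in> C \<Longrightarrow> (u, v) \<in> arcs_ends G \<Longrightarrow> v \<in> C \<union> S"
  shows "(\<Sum>C\<in>\<C>. card (boundary_arcs G C)) \<le> d * card S"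
proof -
  have "(\<Sum>C\<in>\<C>. card (boundary_arcs G C)) = card (\<Union>C\<in>\<C>. boundary_arcs G C)"
  proof (rule card_UN_disjoint[symmetric])
    show "\<forall>C\<in>\<C>. \<forall>D\<in>\<C>. C \<noteq> D \<longrightarrow> boundary_arcs G C \<inter> boundary_arcs G D = {}"
      using disj unfolding boundary_arcs_def by blast
  qed (use fin finite_boundary_arcs in auto)
  also have "\<dots> \<le> card (prod.swap ` (arcs_ends G \<inter> S \<times> verts G))"
  proof (rule card_mono)
    show "(\<Union>C\<in>\<C>. boundary_arcs G C) \<subseteq> prod.swap ` (arcs_ends G \<inter> S \<times> verts G)"
    proof safe
      fix C u v assume C: "C \<in> \<C>" and "(u, v) \<in> boundary_arcs G C"
      then have uv: "u \<in> C" "v \<notin> C" "(u, v) \<in> arcs_ends G" by (auto simp: boundary_arcs_def)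
      then have "(v, u) \<in> arcs_ends G \<inter> S \<times> verts G"
        using closed[OF C] sub[OF C] graph_symmetric by auto
      then show "(u, v) \<in> prod.swap ` (arcs_ends G \<inter> S \<times> verts G)" by force
    qed
  qed (simp add: arcs_ends_def)
  also have "\<dots> \<le> card (arcs_ends G \<inter> S \<times> verts G)"
    by (rule card_image_le) (simp add: arcs_ends_def)
  also have "\<dots> = d * card S" by (rule card_arcs_from_regular[OF reg S])
  finally show ?thesis .
qed

text \<open>
  If \<open>t\<close> of the terms are below \<open>d\<close>, the sum is at least \<open>\<kappa> t + d (l - t)\<close>. Comparing with
  \<open>d (k - 1)\<close> gives \<open>t (d - \<kappa>) \<ge> (l - k + 1) d\<close>.
\<close>

lemma many_small_terms_of_small_sum:
  fixes b :: "'i \<Rightarrow> nat" and \<kappa> d l k :: nat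
  assumes fin: "finite \<C>" and l: "l \<le> card \<C>" and k: "k \<ge> 1" "k \<le> l"
    and lower: "\<And>C. C \<in> \<C> \<Longrightarrow> \<kappa> \<le> b C" and sum: "sum b \<C> \<le> d * (k - 1)"
    and \<kappa>: "\<kappa> < d"
  shows "nat \<lceil>(real l - real k + 1) * real d / (real d - real \<kappa>)\<rceil> \<le> card {C \<in> \<C>. b C < d}"
proof -
  define t where "t = card {C \<in> \<C>. b C < d}"
  have q: "card \<C> = t + card {C \<in> \<C>. \<not> b C < d}"
    unfolding t_def using fin by (subst card_Un_disjoint[symmetric]) (auto intro: arg_cong[of _ _ card])
  have "t * \<kappa> + card {C \<in> \<C>. \<not> b C < d} * d \<le> sum b {C \<in> \<C>. b C < d} + sum b {C \<in> \<C>. \<not> b C < d}"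
    unfolding t_def by (intro add_mono sum_bounded_below[where K = "_ :: nat", simplified])
      (use lower in auto)
  also have "\<dots> = sum b \<C>"
    using fin by (subst sum.union_disjoint[symmetric]) (auto intro: arg_cong[of _ _ "sum b"])
  finally have "t * \<kappa> + card {C \<in> \<C>. \<not> b C < d} * d \<le> d * (k - 1)" using sum by simp
  then have "real (t * \<kappa> + card {C \<in> \<C>. \<not> b C < d} * d) \<le> real (d * (k - 1))"
    by (simp only: of_nat_le_iff)
  then have 1: "real t * real \<kappa> + (real (card \<C>) - real t) * real d \<le> real d * (real k - 1)"
    using k q by (simp add: of_nat_diff)
  have "real l * real d \<le> real (card \<C>) * real d" using l by (intro mult_right_mono) auto
  then have "(real l - real k + 1) * real d \<le> real t * (real d - real \<kappa>)"
    using 1 by (simp add: algebra_simps)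
  then have "(real l - real k + 1) * real d / (real d - real \<kappa>) \<le> real t"
    using \<kappa> by (simp add: divide_le_eq)
  then show ?thesis unfolding t_def[symmetric] by (simp add: ceiling_le_iff nat_le_iff)
qed

theorem theorem1p1:
  fixes G :: "('a, 'b) pre_digraph" and l k d :: nat
  defines "\<kappa>' \<equiv> edge_connectivity G"
  assumes "l \<ge> k" and "k \<ge> 2"
    and "graph G" and "Digraph_Component.connected G"
    and "regular_graph G d" and "d \<ge> 3"
    and "card (verts G) \<ge> k + l - 1"
    and "\<kappa>' = d \<or>
      (\<kappa>' < d \<and>
       graph_eigenvalue G
         (nat \<lceil>(real l - real k + 1) * real d / (real d - real \<kappa>')\<rceil>)
       < (if even d then (real d - 2 + sqrt ((real d)\<^sup>2 + 12)) / 2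
          else (real d - 2 + sqrt ((real d)\<^sup>2 + 8)) / 2))"
  shows "l_connectivity l G \<ge> k"
proof (rule ccontr)
  note lk = \<open>l \<ge> k\<close> \<open>k \<ge> 2\<close> and reg = \<open>regular_graph G d\<close> and d = \<open>d \<ge> 3\<close>
  interpret graph G by fact
  define bad where "bad S \<longleftrightarrow> S \<subseteq> verts G \<and> (let H = delete_vertices G S in
      (\<not> Digraph_Component.connected H \<and> card (pre_digraph.sccs H) \<ge> l)
      \<or> card (verts H) < l)" for S
  assume "\<not> l_connectivity l G \<ge> k"
  moreover have "l_connectivity l G \<in> {card S | S. bad S}"
    unfolding l_connectivity_def bad_def[symmetric]
  proof (rule Inf_nat_def1)
    \<comment> \<open>Removing all vertices is allowed, so the infimum is attained.\<close>
    have "bad (verts G)" using lk by (simp add: bad_def delete_vertices_def)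
    then show "{card S | S. bad S} \<noteq> {}" by blast
  qed
  ultimately obtain S where "bad S" and cS: "card S < k" by auto
  define H where "H = delete_vertices G S"
  have S: "S \<subseteq> verts G" using \<open>bad S\<close> by (simp add: bad_def)
  have "card (verts H) = card (verts G) - card S"
    using S finite_subset[OF S finite_verts] by (simp add: H_def delete_vertices_def card_Diff_subset)
  then have "card (verts H) \<ge> l" using \<open>card (verts G) \<ge> k + l - 1\<close> cS by simp
  then have sccs: "card (pre_digraph.sccs H) \<ge> l"
    using \<open>bad S\<close> by (auto simp: bad_def Let_def H_def)
  define \<C> where "\<C> = pre_digraph.sccs_verts H"
  note comp = vertex_deletion_components[OF H_def, folded \<C>_def]
  have l: "l \<le> card \<C>" using comp(2) sccs by simp
  have lower: "\<kappa>' \<le> card (boundary_arcs G C)" if C: "C \<in> \<C>" for C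
  proof -
    \<comment> \<open>A second component keeps \<open>C\<close> from being the whole vertex set, where nothing is cut.\<close>
    have "\<not> \<C> \<subseteq> {C}" using l lk card_mono[of "{C}" \<C>] by auto
    then obtain D where "D \<in> \<C>" "D \<noteq> C" by auto
    then have "C \<subset> verts G" "C \<noteq> {}" using comp(3)[of C] comp(3)[of D] comp(4)[of C D] C by blast+
    then show ?thesis unfolding \<kappa>'_def by (rule edge_connectivity_le_boundary)
  qed
  have "(\<Sum>C\<in>\<C>. card (boundary_arcs G C)) \<le> d * card S"
    by (rule sum_boundary_components_le[OF reg S]) (use comp in blast)+
  also have "\<dots> \<le> d * (k - 1)" using cS lk by (intro mult_le_mono2) linarith
  finally have sum: "(\<Sum>C\<in>\<C>. card (boundary_arcs G C)) \<le> d * (k - 1)" .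
  show False
  proof (cases "\<kappa>' = d")
    case True
    have "l * d \<le> card \<C> * d" using l by simp
    also have "\<dots> \<le> (\<Sum>C\<in>\<C>. card (boundary_arcs G C))"
      using sum_bounded_below[of \<C> d] lower True by simp
    also note sum
    finally have "l * d \<le> (k - 1) * d" by (simp add: mult.commute)
    then show False using lk d by simp
  next
    case False
    define \<theta> where "\<theta> = (if even d then (real d - 2 + sqrt ((real d)\<^sup>2 + 12)) / 2
      else (real d - 2 + sqrt ((real d)\<^sup>2 + 8)) / 2)"
    define T where "T = nat \<lceil>(real l - real k + 1) * real d / (real d - real \<kappa>')\<rceil>"
    have \<kappa>: "\<kappa>' < d" and small: "graph_eigenvalue G T < \<theta>"
      using False assms(9) by (auto simp: \<theta>_def T_def)
    define \<D> where "\<D> = {C \<in> \<C>. card (boundary_arcs G C) < d}"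
    define t where "t = card \<D>"
    have "T \<le> t"
      unfolding T_def t_def \<D>_def
      by (rule many_small_terms_of_small_sum[OF comp(1) l _ _ lower sum \<kappa>]) (use lk in auto)
    have "0 < (real l - real k + 1) * real d / (real d - real \<kappa>')"
      using lk d \<kappa> by (intro divide_pos_pos mult_pos_pos) auto
    then have "1 \<le> T" unfolding T_def by linarith
    have "finite \<D>" using comp(1) by (simp add: \<D>_def)
    then obtain e where e: "bij_betw e {0..<t} \<D>"
      using ex_bij_betw_nat_finite t_def by blast
    have e\<D>: "e i \<in> \<D>" if "i < t" for i using e that by (auto simp: bij_betw_def)
    have e_inj: "e i \<noteq> e j" if "i < t" "j < t" "i \<noteq> j" for i j
      using e that by (auto simp: bij_betw_def inj_on_def)
    define good where "good C f \<longleftrightarrow> 0 < (\<Sum>u\<in>C. (f u)\<^sup>2) \<and> \<theta> * (\<Sum>u\<in>C. (f u)\<^sup>2)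
        \<le> (\<Sum>u\<in>C. \<Sum>v\<in>C. of_bool ((u, v) \<in> arcs_ends G) * (f u * f v))"
      for C and f :: "'a \<Rightarrow> real"
    have e\<C>: "e i \<in> \<C>" and e_small: "card (boundary_arcs G (e i)) < d" if "i < t" for i
      using e\<D>[OF that] by (auto simp: \<D>_def)
    have e_sub: "e i \<subseteq> verts G" "e i \<noteq> {}" if "i < t" for i
      using comp(3)[OF e\<C>[OF that]] by auto
    have "\<exists>f. good (e i) f" if "i < t" for i
      unfolding good_def \<theta>_def
      by (rule regular_small_boundary_test_function[OF reg d e_sub e_small]) (fact that)+
    then obtain f where f: "\<And>i. i < t \<Longrightarrow> good (e i) (f i)"
      by metis
    have "\<theta> \<le> graph_eigenvalue G T"
    proof (rule separated_test_functions_eigenvalue[where C = e and t = t and f = f])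
      fix i j assume ij: "i < t" "j < t" "i \<noteq> j"
      note mem = e\<C>[OF ij(1)] e\<C>[OF ij(2)]
      show disj: "e i \<inter> e j = {}" using comp(4)[OF mem] e_inj ij by blast
      show "(u, v) \<notin> arcs_ends G" if "u \<in> e i" "v \<in> e j" for u v
        using comp(5)[OF mem(1) that(1), of v] that(2) disj comp(3)[OF mem(2)] by blast
    qed (use f e_sub \<open>1 \<le> T\<close> \<open>T \<le> t\<close> in \<open>simp_all add: good_def graph_axioms\<close>)
    then show False using small by simp
  qed
qed

end
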